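(* Let $G=(V,E)$ be a DAG with input set $I$ and output set $O$, let $r$ be a visit rule of $G_R$, and let $M$ be the cache size. For an $r$-visit $\psi$ of $G_R$ define $\mathcal{W}_r(\psi,M)=\max_{\mathbf{i}\in\mathcal{I}(\psi)}\mathcal{W}_r(\mathbf{i},\psi,M)$ and $\mathcal{R}_r(\psi,M)=\max_{\mathbf{i}\in\mathcal{I}(\psi)}\mathcal{R}_r(\mathbf{i},\psi,M)$, where $\mathcal{I}(\psi)$ is the set of all segment partitions of $\psi$. Then, with the minima taken over all $r$-visits $\psi$ of $G_R$, $IO_{\mathcal W}(G,M)\geq\min_{\psi}\mathcal{W}_r(\psi,M)$, $IO_{\mathcal R}(G,M)\geq\min_{\psi}\max\{\mathcal{R}_r(\psi,M),\ \mathcal{W}_r(\psi,M)+|I|-|O|\}$, $IO(G,M)\geq\min_{\psi}\{\mathcal{W}_r(\psi,M)+\max\{\mathcal{R}_r(\psi,M),\ \mathcal{W}_r(\psi,M)+|I|-|O|\}\}$.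
   Context: DAG $G=(V,E)$: inputs $I$ are vertices with no predecessors, outputs $O$ those with no successors. The reverse DAG is $G_R=(V,E_R)$ with $E_R=\{(u,v):(v,u)\in E\}$; its input set is $I_R=O$. A visit rule $r$ of $G_R$ assigns to each $v$ a non-empty family $r(v)$ of subsets of the predecessors of $v$ in $G_R$ (enablers). An $r$-sequence is a sequence of distinct vertices each of whose entries $\psi[i]$ has some $Q\in r(\psi[i])$ contained in $\psi[1..i-1]$; an $r$-visit is an $r$-sequence containing all $n=|V|$ vertices. $B_r(\psi)=\{v\notin\psi : \exists Q\neq\emptyset,\ Q\in r(v),\ Q\subseteq\psi\}$ (boundary in $G_R$; $B_r$ of the empty sequence is empty). A segment partition of an $r$-visit $\psi$ is $\mathbf{i}=(i_1,\ldots,i_k)$ with $1\le i_1<\cdots<i_k=n$, $i_0=0$; its $j$-th segment is $\psi(i_{j-1}..i_j]=(\psi[i_{j-1}+1],\ldots,\psi[i_j])$. Entering boundary: $b^{(ent)}_r(\psi(i_{j-1}..i_j])=|(I_R\cup B_r(\psi[1..i_{j-1}]))\cap\psi(i_{j-1}..i_j]|$. A set $P$ is a post-dominator of $X$ in $G_R$ if every directed path in $G_R$ from a vertex of $X$ to an output vertex of $G_R$ intersects $P$; $pd_{min}(X)$ is its minimum size. Define $\mathcal{W}_r(\mathbf{i},\psi,M)=\sum_{j=1}^{k}\max\{0,b^{(ent)}_r(\psi(i_{j-1}..i_j])-M\}$ and $\mathcal{R}_r(\mathbf{i},\psi,M)=\sum_{j=1}^{k}\max\{0,pd_{min}(\psi(i_{j-1}..i_j])-M\}$.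 I/O model: cache of $M$ words, unbounded slow memory, one vertex value per word. A computation is a sequence of steps, each being an operation evaluating a vertex $v\in V\setminus I$ into cache (requires all predecessors of $v$ in $G$ to be in cache), a read (slow memory to cache), or a write (cache to slow memory); at most $M$ values in cache at any time (values may be discarded at any time); recomputation allowed; inputs initially in slow memory only; outputs must be in slow memory at the end. $IO_{\mathcal W}(G,M)$, $IO_{\mathcal R}(G,M)$, $IO(G,M)$ denote the minimum, over all computations of $G$, of the number of writes, of reads, and of reads plus writes, respectively.
   Formalization: The formal theorem additionally assumes that no vertex is both an input and an output of G (no isolated vertices); without this the bounds fail, e.g. for two isolated vertices and M=1, where no I/O is needed but W_r=R_r=1 for every visit. *)

theory Defs
  imports "HOL-Library.Extended_Real"
begin

definition dag :: "'a set \<Rightarrow> ('a \<times> 'a) set \<Rightarrow> bool" where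
  "dag V E \<longleftrightarrow> finite V \<and> E \<subseteq> V \<times> V \<and> acyclic E"

definition preds :: "('a \<times> 'a) set \<Rightarrow> 'a \<Rightarrow> 'a set" where
  "preds E v = {u. (u, v) \<in> E}"

definition succs :: "('a \<times> 'a) set \<Rightarrow> 'a \<Rightarrow> 'a set" where
  "succs E v = {w. (v, w) \<in> E}"

definition inputs :: "'a set \<Rightarrow> ('a \<times> 'a) set \<Rightarrow> 'a set" where
  "inputs V E = {v \<in> V. preds E v = {}}"

definition outputs :: "'a set \<Rightarrow> ('a \<times> 'a) set \<Rightarrow> 'a set" where
  "outputs V E = {v \<in> V. succs E v = {}}"


section \<open>Visits\<close>

text \<open>
  In this section and the next one \<open>E\<close> is the edge set of the graph being visited.  To visit the
  reverse of a DAG with edge set \<open>E\<close>, instantiate it with \<open>E\<inverse>\<close>.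
\<close>

definition visit_rule :: "'a set \<Rightarrow> ('a \<times> 'a) set \<Rightarrow> ('a \<Rightarrow> 'a set set) \<Rightarrow> bool" where
  "visit_rule V E r \<longleftrightarrow> (\<forall>v\<in>V. r v \<noteq> {} \<and> (\<forall>Q\<in>r v. Q \<subseteq> preds E v))"

definition r_sequence :: "'a set \<Rightarrow> ('a \<Rightarrow> 'a set set) \<Rightarrow> 'a list \<Rightarrow> bool" where
  "r_sequence V r \<psi> \<longleftrightarrow> set \<psi> \<subseteq> V \<and> distinct \<psi> \<and>
     (\<forall>i<length \<psi>. \<exists>Q\<in>r (\<psi> ! i). Q \<subseteq> set (take i \<psi>))"

definition r_visits :: "'a set \<Rightarrow> ('a \<Rightarrow> 'a set set) \<Rightarrow> 'a list set" where
  "r_visits V r = {\<psi>. r_sequence V r \<psi> \<and> set \<psi> = V}"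

definition boundary :: "'a set \<Rightarrow> ('a \<Rightarrow> 'a set set) \<Rightarrow> 'a list \<Rightarrow> 'a set" where
  "boundary V r \<psi> = {v \<in> V - set \<psi>. \<exists>Q\<in>r v. Q \<noteq> {} \<and> Q \<subseteq> set \<psi>}"


section \<open>Segment partitions\<close>

text \<open>
  The list \<open>ix = [i\<^sub>1, \<dots>, i\<^sub>k]\<close> omits \<open>i\<^sub>0 = 0\<close>, so that \<open>i\<^bsub>j-1\<^esub> = (0 # ix) ! (j - 1)\<close>.
  If the visit is nonempty, so is \<open>ix\<close>; the visit of the empty graph has the partition \<open>[]\<close> only.
\<close>

definition seg_partitions :: "'a list \<Rightarrow> nat list set" where
  "seg_partitions \<psi> = {ix. sorted_wrt (<) (0 # ix) \<and> last (0 # ix) = length \<psi>}"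

definition segment :: "'a list \<Rightarrow> nat \<Rightarrow> nat \<Rightarrow> 'a list" where
  "segment \<psi> a b = drop a (take b \<psi>)"

definition entering :: "'a set \<Rightarrow> ('a \<times> 'a) set \<Rightarrow> ('a \<Rightarrow> 'a set set) \<Rightarrow> 'a list \<Rightarrow> nat \<Rightarrow> nat \<Rightarrow> nat"
  where
  "entering V E r \<psi> a b =
     card ((inputs V E \<union> boundary V r (take a \<psi>)) \<inter> set (segment \<psi> a b))"

text \<open>A path is its nonempty list of vertices; the one-vertex path is included.\<close>

definition is_path :: "('a \<times> 'a) set \<Rightarrow> 'a list \<Rightarrow> bool" where
  "is_path E p \<longleftrightarrow> p \<noteq> [] \<and> successively (\<lambda>u v. (u, v) \<in> E) p"

definition post_dominator :: "'a set \<Rightarrow> ('a \<times> 'a) set \<Rightarrow> 'a set \<Rightarrow> 'a set \<Rightarrow> bool" where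
  "post_dominator V E P X \<longleftrightarrow> P \<subseteq> V \<and>
     (\<forall>p. is_path E p \<and> hd p \<in> X \<and> last p \<in> outputs V E \<longrightarrow> set p \<inter> P \<noteq> {})"

definition pd_min :: "'a set \<Rightarrow> ('a \<times> 'a) set \<Rightarrow> 'a set \<Rightarrow> nat" where
  "pd_min V E X = Min (card ` {P. post_dominator V E P X})"

definition W_part ::
  "'a set \<Rightarrow> ('a \<times> 'a) set \<Rightarrow> ('a \<Rightarrow> 'a set set) \<Rightarrow> nat list \<Rightarrow> 'a list \<Rightarrow> nat \<Rightarrow> int" where
  "W_part V E r ix \<psi> M =
     (\<Sum>j<length ix. max 0 (int (entering V E r \<psi> ((0 # ix) ! j) (ix ! j)) - int M))"

definition R_part ::
  "'a set \<Rightarrow> ('a \<times> 'a) set \<Rightarrow> nat list \<Rightarrow> 'a list \<Rightarrow> nat \<Rightarrow> int" where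
  "R_part V E ix \<psi> M =
     (\<Sum>j<length ix. max 0 (int (pd_min V E (set (segment \<psi> ((0 # ix) ! j) (ix ! j)))) - int M))"

definition W_visit ::
  "'a set \<Rightarrow> ('a \<times> 'a) set \<Rightarrow> ('a \<Rightarrow> 'a set set) \<Rightarrow> 'a list \<Rightarrow> nat \<Rightarrow> int" where
  "W_visit V E r \<psi> M = (MAX ix\<in>seg_partitions \<psi>. W_part V E r ix \<psi> M)"

definition R_visit :: "'a set \<Rightarrow> ('a \<times> 'a) set \<Rightarrow> 'a list \<Rightarrow> nat \<Rightarrow> int" where
  "R_visit V E \<psi> M = (MAX ix\<in>seg_partitions \<psi>. R_part V E ix \<psi> M)"


section \<open>I/O model\<close>

datatype 'a step = Compute 'a | Read 'a | Write 'a | Discard 'a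

text \<open>
  A memory state is the pair of the set of values in cache and the set of values in slow memory.
  The value computed by an operation occupies a word of cache in addition to its operands.
\<close>

inductive exec_step ::
  "'a set \<Rightarrow> ('a \<times> 'a) set \<Rightarrow> nat \<Rightarrow> 'a set \<times> 'a set \<Rightarrow> 'a step \<Rightarrow> 'a set \<times> 'a set \<Rightarrow> bool"
  for V :: "'a set" and E :: "('a \<times> 'a) set" and M :: nat where
  compute_step: "v \<in> V - inputs V E \<Longrightarrow> preds E v \<subseteq> C \<Longrightarrow> card (insert v C) \<le> M \<Longrightarrow>
    exec_step V E M (C, S) (Compute v) (insert v C, S)"
| read_step: "v \<in> S \<Longrightarrow> card (insert v C) \<le> M \<Longrightarrow>
    exec_step V E M (C, S) (Read v) (insert v C, S)"
| write_step: "v \<in> C \<Longrightarrow> exec_step V E M (C, S) (Write v) (C, insert v S)"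
| discard_step: "v \<in> C \<Longrightarrow> exec_step V E M (C, S) (Discard v) (C - {v}, S)"

inductive exec ::
  "'a set \<Rightarrow> ('a \<times> 'a) set \<Rightarrow> nat \<Rightarrow> 'a set \<times> 'a set \<Rightarrow> 'a step list \<Rightarrow> 'a set \<times> 'a set \<Rightarrow> bool"
  for V :: "'a set" and E :: "('a \<times> 'a) set" and M :: nat where
  Nil: "exec V E M s [] s"
| Cons: "exec_step V E M s x s' \<Longrightarrow> exec V E M s' xs s'' \<Longrightarrow> exec V E M s (x # xs) s''"

definition computations :: "'a set \<Rightarrow> ('a \<times> 'a) set \<Rightarrow> nat \<Rightarrow> 'a step list set" where
  "computations V E M =
     {xs. \<exists>C S. exec V E M ({}, inputs V E) xs (C, S) \<and> outputs V E \<subseteq> S}"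

definition num_writes :: "'a step list \<Rightarrow> nat" where
  "num_writes xs = length (filter (\<lambda>x. \<exists>v. x = Write v) xs)"

definition num_reads :: "'a step list \<Rightarrow> nat" where
  "num_reads xs = length (filter (\<lambda>x. \<exists>v. x = Read v) xs)"

text \<open>
  An isolated vertex is an input and an output at once, so it is in slow memory from the start and
  no step involves it, although it counts in \<open>entering\<close> and \<open>pd_min\<close>.  Hence lower bounds on I/O by
  these quantities need \<open>inputs V E \<inter> outputs V E = {}\<close>: with two isolated vertices and \<open>M = 1\<close>, nothing
  is read or written, but every visit has \<open>W_visit = R_visit = 1\<close>.
\<close>

text \<open>These minima are \<open>\<infinity>\<close> if the cache is too small for the DAG to be computed at all.\<close>

definition IO_W :: "'a set \<Rightarrow> ('a \<times> 'a) set \<Rightarrow> nat \<Rightarrow> enat" where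
  "IO_W V E M = (INF xs\<in>computations V E M. enat (num_writes xs))"

definition IO_R :: "'a set \<Rightarrow> ('a \<times> 'a) set \<Rightarrow> nat \<Rightarrow> enat" where
  "IO_R V E M = (INF xs\<in>computations V E M. enat (num_reads xs))"

definition IO :: "'a set \<Rightarrow> ('a \<times> 'a) set \<Rightarrow> nat \<Rightarrow> enat" where
  "IO V E M = (INF xs\<in>computations V E M. enat (num_reads xs + num_writes xs))"


section \<open>All minima and maxima range over finite nonempty sets\<close>

lemma dag_converse: "dag V E \<Longrightarrow> dag V (E\<inverse>)"
  by (auto simp: dag_def)

lemma finite_seg_partitions: "finite (seg_partitions \<psi>)"
proof (rule finite_subset)
  show "seg_partitions \<psi> \<subseteq> {ix. set ix \<subseteq> {..length \<psi>} \<and> distinct ix}"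
  proof
    fix ix assume "ix \<in> seg_partitions \<psi>"
    then have s: "sorted_wrt (<) ix" and l: "last (0 # ix) = length \<psi>"
      by (auto simp: seg_partitions_def)
    have "x \<le> length \<psi>" if "x \<in> set ix" for x
    proof -
      have "ix = butlast ix @ [last ix]" using that by (cases ix) auto
      moreover have "sorted_wrt (<) (butlast ix @ [last ix])"
        using s calculation by simp
      ultimately have "x \<le> last ix"
        using that by (metis UnE order.strict_implies_order empty_iff empty_set eq_iff list.set_intros(1)
            set_ConsD set_append sorted_wrt_append)
      then show ?thesis using l that by (cases ix) auto
    qed
    then show "ix \<in> {ix. set ix \<subseteq> {..length \<psi>} \<and> distinct ix}"
      using s strict_sorted_iff by auto
  qed
  show "finite {ix. set ix \<subseteq> {..length \<psi>} \<and> distinct ix}"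
    by (rule finite_subset_distinct) simp
qed

lemma seg_partitions_nonempty: "seg_partitions \<psi> \<noteq> {}"
proof (cases "\<psi> = []")
  case True
  then have "[] \<in> seg_partitions \<psi>" by (simp add: seg_partitions_def)
  then show ?thesis by blast
next
  case False
  then have "[length \<psi>] \<in> seg_partitions \<psi>" by (simp add: seg_partitions_def)
  then show ?thesis by blast
qed

lemma finite_post_dominators: "finite V \<Longrightarrow> finite {P. post_dominator V E P X}"
  by (rule finite_subset[of _ "Pow V"]) (auto simp: post_dominator_def)

lemma post_dominators_nonempty: "{P. post_dominator V E P X} \<noteq> {}"
proof -
  have "post_dominator V E V X"
    unfolding post_dominator_def is_path_def outputs_def
    using last_in_set by fastforce
  then show ?thesis by blast
qed

lemma finite_r_visits: "finite V \<Longrightarrow> finite (r_visits V r)"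
  by (rule finite_subset[OF _ finite_subset_distinct[of V]]) (auto simp: r_visits_def r_sequence_def)

lemma r_visits_nonempty:
  assumes "dag V E" "visit_rule V E r"
  shows "r_visits V r \<noteq> {}"
proof -
  have fin: "finite V" and sub: "E \<subseteq> V \<times> V" and ac: "acyclic E"
    using assms(1) by (auto simp: dag_def)
  have wf: "wf E"
    using ac sub fin by (meson finite_acyclic_wf finite_SigmaI finite_subset)
  have "\<exists>\<psi>. r_sequence V r \<psi> \<and> length \<psi> = k" if "k \<le> card V" for k
    using that
  proof (induction k)
    case 0
    show ?case by (auto simp: r_sequence_def)
  next
    case (Suc k)
    then obtain \<psi> where \<psi>: "r_sequence V r \<psi>" "length \<psi> = k" by auto
    then have "card (set \<psi>) < card V"
      using Suc.prems by (simp add: r_sequence_def distinct_card)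
    then obtain v0 where "v0 \<in> V - set \<psi>"
      using \<psi>(1) by (metis DiffI card_mono finite_set leD subsetI)
    then obtain v where v: "v \<in> V - set \<psi>" and m: "\<And>u. (u, v) \<in> E \<Longrightarrow> u \<notin> V - set \<psi>"
      using wf by (metis wfE_min)
    have "preds E v \<subseteq> set \<psi>" using m sub by (auto simp: preds_def)
    then obtain Q where "Q \<in> r v" "Q \<subseteq> set \<psi>"
      using assms(2) v by (fastforce simp: visit_rule_def)
    then have "r_sequence V r (\<psi> @ [v])"
      using \<psi>(1) v by (auto simp: r_sequence_def nth_append less_Suc_eq)
    then show ?case using \<psi>(2) by (intro exI[of _ "\<psi> @ [v]"]) simp
  qed
  then obtain \<psi> where \<psi>: "r_sequence V r \<psi>" "length \<psi> = card V" by blast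
  then have "set \<psi> = V"
    using fin by (simp add: r_sequence_def distinct_card card_subset_eq)
  then show ?thesis using \<psi>(1) by (auto simp: r_visits_def)
qed

end

theory Submission
  imports Defs
begin

text \<open>
  Scan a computation of \<open>G\<close> backwards.  When an operation evaluates \<open>x\<close> and \<open>x\<close> is unvisited and
  enabled, visit \<open>x\<close>, followed by the unvisited enabled inputs among the operands of \<open>x\<close>; every
  vertex of \<open>G\<close> is eventually visited.  Each position of the visit then corresponds to a time of the
  computation.  A vertex of the boundary at a position is still going to be used later on and is not
  evaluated in between, so it is in cache or it is a non-input that is read later, hence has been
  written.  At most \<open>M\<close> vertices are in cache, so the sum of the excesses of the entering boundaries
  is at most the number of outputs and of non-inputs that are read.  All these are written, and
  replacing the outputs by the inputs gives vertices that are all read.  Likewise, the vertices of a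
  segment are in cache at some moment of a time interval, so they are dominated in \<open>G\<close> by the cache
  contents at the start of that interval together with the vertices read during it.
\<close>

section \<open>Sums over segment partitions\<close>

text \<open>Telescoping: consecutive segments share an endpoint, so the increments of the potential
  \<open>F\<close> add up. For writes \<open>F\<close> counts visited vertices, for reads it counts
  reads.\<close>

lemma sum_seg_partition_le:
  fixes F :: "nat \<Rightarrow> int" and h :: "nat \<Rightarrow> nat \<Rightarrow> int"
  assumes ix: "ix \<in> seg_partitions \<psi>"
    and le: "\<And>a b. a \<le> b \<Longrightarrow> b \<le> length \<psi> \<Longrightarrow> h a b \<le> F b - F a"
  shows "(\<Sum>j<length ix. h ((0 # ix) ! j) (ix ! j)) \<le> F (length \<psi>) - F 0"
proof -
  have s: "sorted_wrt (<) (0 # ix)" and l: "last (0 # ix) = length \<psi>"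
    using ix by (auto simp: seg_partitions_def)
  have l': "(0 # ix) ! length ix = length \<psi>"
    using l by (metis diff_Suc_1 last_conv_nth length_Cons list.distinct(1))
  have "h ((0 # ix) ! j) (ix ! j) \<le> F ((0 # ix) ! Suc j) - F ((0 # ix) ! j)" if "j < length ix" for j
  proof -
    have "(0 # ix) ! j < (0 # ix) ! Suc j"
      using s that by (intro sorted_wrt_nth_less[OF s]) auto
    moreover have "(0 # ix) ! Suc j \<le> (0 # ix) ! length ix"
    proof (cases "Suc j = length ix")
      case False
      then have "(0 # ix) ! Suc j < (0 # ix) ! length ix"
        using that by (intro sorted_wrt_nth_less[OF s]) auto
      then show ?thesis by simp
    qed simp
    ultimately show ?thesis using le[of "(0 # ix) ! j" "ix ! j"] l' by simp
  qed
  then have "(\<Sum>j<length ix. h ((0 # ix) ! j) (ix ! j))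
      \<le> (\<Sum>j<length ix. F ((0 # ix) ! Suc j) - F ((0 # ix) ! j))"
    by (intro sum_mono) auto
  also have "\<dots> = F (length \<psi>) - F 0"
    using sum_lessThan_telescope[of "\<lambda>j. F ((0 # ix) ! j)" "length ix"] l' by simp
  finally show ?thesis .
qed

lemma card_Int_segment:
  assumes "distinct \<psi>" "a \<le> b"
  shows "card (Z \<inter> set (take b \<psi>)) = card (Z \<inter> set (take a \<psi>)) + card (Z \<inter> set (segment \<psi> a b))"
proof -
  have eq: "take b \<psi> = take a \<psi> @ segment \<psi> a b"
    using assms(2) unfolding segment_def by (metis append_take_drop_id min.absorb1 take_take)
  have "distinct (take b \<psi>)" using assms(1) by simp
  then have "set (take a \<psi>) \<inter> set (segment \<psi> a b) = {}" using eq by (metis distinct_append)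
  then show ?thesis unfolding eq set_append Int_Un_distrib
    by (subst card_Un_disjoint) auto
qed


section \<open>Post-dominators\<close>

lemma post_dominator_mono:
  "post_dominator V E P X \<Longrightarrow> P \<subseteq> P' \<Longrightarrow> P' \<subseteq> V \<Longrightarrow> X' \<subseteq> X \<Longrightarrow> post_dominator V E P' X'"
  unfolding post_dominator_def by blast

lemma post_dominator_Un:
  "post_dominator V E P X \<Longrightarrow> post_dominator V E P Y \<Longrightarrow> post_dominator V E P (X \<union> Y)"
  unfolding post_dominator_def by blast

lemma post_dominator_refl: "P \<subseteq> V \<Longrightarrow> post_dominator V E P P"
  unfolding post_dominator_def is_path_def using list.set_sel(1) by fastforce

text \<open>A path from \<open>v\<close> cannot end at \<open>v\<close>, so its second vertex lies
  in \<open>X\<close> and the rest of the path meets \<open>P\<close>. In the reverse graph the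
  successors are the operands, so this covers the evaluation of a vertex.\<close>

lemma post_dominator_insert:
  assumes P: "post_dominator V E P X" and v: "v \<notin> outputs V E" "succs E v \<subseteq> X"
  shows "post_dominator V E P (insert v X)"
  unfolding post_dominator_def
proof (intro conjI allI impI)
  show "P \<subseteq> V" using P by (simp add: post_dominator_def)
  fix p assume p: "is_path E p \<and> hd p \<in> insert v X \<and> last p \<in> outputs V E"
  show "set p \<inter> P \<noteq> {}"
  proof (cases "hd p \<in> X")
    case True
    then show ?thesis using P p by (auto simp: post_dominator_def)
  next
    case False
    then obtain q where q: "p = v # q" using p by (cases p) (auto simp: is_path_def)
    with p v have "q \<noteq> []" by auto
    then have "is_path E q" "(v, hd q) \<in> E" "last q \<in> outputs V E"
      using p q by (auto simp: is_path_def successively_Cons)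
    then have "set q \<inter> P \<noteq> {}" using P v(2) by (auto simp: post_dominator_def succs_def)
    then show ?thesis using q by auto
  qed
qed

lemma pd_min_le:
  assumes "finite V" "post_dominator V E P X"
  shows "pd_min V E X \<le> card P"
  unfolding pd_min_def using assms finite_post_dominators[OF assms(1)] by (intro Min_le) auto

lemma outputs_converse [simp]: "outputs V (E\<inverse>) = inputs V E"
  by (auto simp: outputs_def inputs_def succs_def preds_def)

lemma inputs_converse [simp]: "inputs V (E\<inverse>) = outputs V E"
  by (auto simp: outputs_def inputs_def succs_def preds_def)

lemma succs_converse [simp]: "succs (E\<inverse>) v = preds E v"
  by (auto simp: succs_def preds_def)


section \<open>Visits extracted from computations\<close>

text \<open>States indexed by time allow a backward scan and the comparison of distant
  states.\<close>

lemma exec_states: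
  assumes "exec V E M s xs s'"
  shows "\<exists>st. st 0 = s \<and> st (length xs) = s' \<and>
    (\<forall>k<length xs. exec_step V E M (st k) (xs ! k) (st (Suc k)))"
  using assms
proof (induction rule: exec.induct)
  case (Nil s)
  show ?case by (intro exI[of _ "\<lambda>_. s"]) simp
next
  case (Cons s x s' xs s'')
  then obtain st where st: "st 0 = s'" "st (length xs) = s''"
    "\<forall>k<length xs. exec_step V E M (st k) (xs ! k) (st (Suc k))" by blast
  show ?case
    using st Cons.hyps(1)
    by (intro exI[of _ "\<lambda>k. case k of 0 \<Rightarrow> s | Suc m \<Rightarrow> st m"]) (auto simp: nth_Cons split: nat.split)
qed

locale computation_run =
  fixes V :: "'a set" and E :: "('a \<times> 'a) set" and r :: "'a \<Rightarrow> 'a set set" and M :: nat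
    and xs :: "'a step list" and C S :: "nat \<Rightarrow> 'a set"
  assumes dag: "dag V E"
    and disj: "inputs V E \<inter> outputs V E = {}"
    and rule: "visit_rule V (E\<inverse>) r"
    and C_0: "C 0 = {}" and S_0: "S 0 = inputs V E"
    and step: "k < length xs \<Longrightarrow> exec_step V E M (C k, S k) (xs ! k) (C (Suc k), S (Suc k))"
    and outputs_written: "outputs V E \<subseteq> S (length xs)"
begin

abbreviation "Inp \<equiv> inputs V E"
abbreviation "Out \<equiv> outputs V E"
abbreviation "N \<equiv> length xs"

text \<open>Step \<open>j\<close> leads from state \<open>j\<close> to state \<open>Suc j\<close>,
  so these reads happen between states \<open>a\<close> and \<open>b\<close>.\<close>

definition reads_between :: "nat \<Rightarrow> nat \<Rightarrow> 'a set" where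
  "reads_between a b = {v. \<exists>j. a \<le> j \<and> j < b \<and> xs ! j = Read v}"

abbreviation "Rd \<equiv> reads_between 0 N"

definition written :: "'a set" where "written = {v. Write v \<in> set xs}"

section \<open>Cache and slow memory along a computation\<close>

lemma finite_V: "finite V" and edges: "E \<subseteq> V \<times> V"
  using dag by (auto simp: dag_def)

lemma enabler_succs: "v \<in> V \<Longrightarrow> Q \<in> r v \<Longrightarrow> w \<in> Q \<Longrightarrow> (v, w) \<in> E"
  using rule by (auto simp: visit_rule_def preds_def)

lemma state_subset: "k \<le> N \<Longrightarrow> C k \<subseteq> V \<and> S k \<subseteq> V \<and> card (C k) \<le> M"
proof (induction k)
  case 0
  then show ?case by (auto simp: C_0 S_0 inputs_def)
next
  case (Suc k)
  then have IH: "C k \<subseteq> V" "S k \<subseteq> V" "card (C k) \<le> M" by auto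
  moreover have "card (C k - {v}) \<le> M" for v
    using IH finite_V by (meson card_Diff1_le finite_subset le_trans)
  moreover from step[of k] Suc.prems
  have "exec_step V E M (C k, S k) (xs ! k) (C (Suc k), S (Suc k))" by simp
  then have "C (Suc k) \<subseteq> V \<and> S (Suc k) \<subseteq> V \<and>
      (card (C (Suc k)) \<le> M \<or> (\<exists>v. C (Suc k) = C k - {v}))"
    using IH by (cases rule: exec_step.cases) auto
  ultimately show ?case by metis
qed

lemma slow_memory_written: "k \<le> N \<Longrightarrow> S k \<subseteq> Inp \<union> written"
proof (induction k)
  case 0
  then show ?case by (simp add: S_0)
next
  case (Suc k)
  then have IH: "S k \<subseteq> Inp \<union> written" by auto
  have k: "xs ! k \<in> set xs" using Suc.prems by simp
  from step[of k] Suc.prems have "exec_step V E M (C k, S k) (xs ! k) (C (Suc k), S (Suc k))" by simp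
  then show ?case using IH k by (cases rule: exec_step.cases) (auto simp: written_def)
qed

lemma reads_written: "Rd - Inp \<subseteq> written"
proof
  fix v assume v: "v \<in> Rd - Inp"
  then obtain j where j: "j < N" "xs ! j = Read v" by (auto simp: reads_between_def)
  with step[of j] have "v \<in> S j" by (auto elim: exec_step.cases)
  then show "v \<in> written" using slow_memory_written[of j] j v by auto
qed

text \<open>Here the disjointness of inputs and outputs enters: no output is in slow memory at the
  start.\<close>

lemma outputs_subset_written: "Out \<subseteq> written"
  using slow_memory_written[of N] outputs_written disj by auto

lemma reads_between_Suc:
  "a \<le> k \<Longrightarrow> reads_between a (Suc k) = reads_between a k \<union> {v. xs ! k = Read v}"
  by (auto simp: reads_between_def less_Suc_eq)

text \<open>Inputs are never evaluated, so they enter the cache only by a read.\<close>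

lemma cached_input_read: "k \<le> N \<Longrightarrow> C k \<inter> Inp \<subseteq> reads_between 0 k"
proof (induction k)
  case 0
  then show ?case by (simp add: C_0)
next
  case (Suc k)
  then have IH: "C k \<inter> Inp \<subseteq> reads_between 0 k" by auto
  from step[of k] Suc.prems have "exec_step V E M (C k, S k) (xs ! k) (C (Suc k), S (Suc k))" by simp
  then show ?case using IH
    by (cases rule: exec_step.cases) (auto simp: reads_between_Suc)
qed

lemma reads_between_subset: "b \<le> N \<Longrightarrow> reads_between a b \<subseteq> V"
proof
  fix v assume "b \<le> N" "v \<in> reads_between a b"
  then obtain j where j: "j < N" "xs ! j = Read v"
    by (auto simp: reads_between_def dest: less_le_trans)
  with step[of j] have "v \<in> S j" by (auto elim: exec_step.cases)
  then show "v \<in> V" using state_subset[of j] j by auto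
qed

text \<open>The cache gains vertices by reads, which belong to the dominator itself, and by
  evaluations, whose operands are in cache and thus already dominated.\<close>

lemma cache_dominated:
  assumes "a \<le> b" "b \<le> N"
  shows "post_dominator V (E\<inverse>) (C a \<union> reads_between a b) (\<Union>k\<in>{a..b}. C k)"
  using assms
proof (induction b rule: dec_induct)
  case base
  then show ?case using state_subset[of a]
    by (intro post_dominator_mono[OF post_dominator_refl[of "C a"]]) (auto simp: reads_between_def)
next
  case (step b)
  let ?X = "\<Union>k\<in>{a..b}. C k"
  let ?P = "C a \<union> reads_between a (Suc b)"
  have P: "?P \<subseteq> V"
    using state_subset[of a] reads_between_subset step.hyps step.prems by auto
  have X: "post_dominator V (E\<inverse>) ?P ?X"
    using step P by (intro post_dominator_mono[OF step.IH]) (auto simp: reads_between_Suc)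
  have "exec_step V E M (C b, S b) (xs ! b) (C (Suc b), S (Suc b))"
    using computation_run.step[OF computation_run_axioms] step.prems by simp
  then have "post_dominator V (E\<inverse>) ?P (?X \<union> C (Suc b))"
  proof (cases rule: exec_step.cases)
    case (compute_step v)
    have "post_dominator V (E\<inverse>) ?P (insert v ?X)"
      using compute_step step.hyps by (intro post_dominator_insert[OF X]) auto
    then show ?thesis
      using compute_step step.hyps P by (elim post_dominator_mono) auto
  next
    case (read_step v)
    have "post_dominator V (E\<inverse>) ?P (?X \<union> ?P)"
      by (intro post_dominator_Un X post_dominator_refl P)
    then show ?thesis
      using read_step step.hyps P by (elim post_dominator_mono) (auto simp: reads_between_Suc)
  next
    case (write_step v)
    then show ?thesis using X step.hyps P by (elim post_dominator_mono) auto
  next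
    case (discard_step v)
    then show ?thesis using X step.hyps P by (elim post_dominator_mono) auto
  qed
  then show ?case using P by (elim post_dominator_mono) (auto simp: le_Suc_eq)
qed

section \<open>Counting reads and writes\<close>

lemma card_reads_between:
  assumes "a \<le> b" "b \<le> N"
  shows "num_reads (take a xs) + card (reads_between a b) \<le> num_reads (take b xs)"
  using assms
proof (induction b rule: dec_induct)
  case base
  have "reads_between a a = {}" by (auto simp: reads_between_def)
  then show ?case by simp
next
  case (step b)
  then have IH: "num_reads (take a xs) + card (reads_between a b) \<le> num_reads (take b xs)" by simp
  have *: "take (Suc b) xs = take b xs @ [xs ! b]" using step by (simp add: take_Suc_conv_app_nth)
  show ?case
  proof (cases "xs ! b")
    case (Read v)
    \<comment> \<open>Rereading a vertex adds to the number of reads but not to the set, hence only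
      an inequality.\<close>
    have "card (insert v (reads_between a b)) \<le> Suc (card (reads_between a b))"
      by (simp add: card_insert_le_m1)
    then show ?thesis using IH step.hyps Read by (simp add: * num_reads_def reads_between_Suc)
  qed (use IH step.hyps in \<open>simp_all add: * num_reads_def reads_between_Suc\<close>)
qed

lemma card_written: "finite written" "card written \<le> num_writes xs"
proof -
  have sub: "Write ` written \<subseteq> set (filter (\<lambda>x. \<exists>v. x = Write v) xs)" by (auto simp: written_def)
  have inj: "inj_on Write written" by (auto simp: inj_on_def)
  show "finite written" using sub inj by (meson finite_imageD finite_set finite_subset)
  have "card written \<le> card (set (filter (\<lambda>x. \<exists>v. x = Write v) xs))"
    using card_mono[OF _ sub] card_image[OF inj] by simp
  then show "card written \<le> num_writes xs"
    unfolding num_writes_def using card_length le_trans by blast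
qed

text \<open>Enabled vertices whose value is still needed in the backward scan: an output at the end,
  any other vertex as an operand of a visited one. The edge replaces the nonempty enabler of
  \<open>boundary\<close>, so that a vertex enabled only by the empty set is tracked as
  well.\<close>

definition pending :: "'a list \<Rightarrow> 'a set" where
  "pending \<psi> = {v \<in> V - set \<psi>. (\<exists>Q\<in>r v. Q \<subseteq> set \<psi>) \<and> (v \<in> Out \<or> (\<exists>w\<in>set \<psi>. (v, w) \<in> E))}"

text \<open>
  \<open>\<tau> i\<close> is the time, as an index into the states of the computation, of the cut after the first \<open>i\<close>
  visited vertices; inputs visited along with a vertex get the same time as that vertex.
\<close>

definition timed_visit :: "'a list \<Rightarrow> (nat \<Rightarrow> nat) \<Rightarrow> bool" where
  "timed_visit \<psi> \<tau> \<longleftrightarrow> r_sequence V r \<psi> \<and> \<tau> 0 = N \<and>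
     (\<forall>i<length \<psi>. \<tau> (Suc i) \<le> \<tau> i \<and> (\<exists>k. \<tau> (Suc i) \<le> k \<and> k \<le> \<tau> i \<and> \<psi> ! i \<in> C k)) \<and>
     (\<forall>i\<le>length \<psi>. boundary V r (take i \<psi>) \<subseteq> C (\<tau> i) \<union> (Rd - Inp))"

text \<open>The invariant of the scan at state \<open>k\<close>. An input is never evaluated, so it
  is visited right after the vertex that makes it pending. The restriction to
  \<open>Rd \<union> Out\<close> places the boundary, which is free of outputs, in
  \<open>C k \<union> (Rd - Inp)\<close>.\<close>

definition ready :: "nat \<Rightarrow> 'a list \<Rightarrow> bool" where
  "ready k \<psi> \<longleftrightarrow> pending \<psi> \<inter> Inp = {} \<and> pending \<psi> \<subseteq> C k \<union> (S k \<inter> (Rd \<union> Out))"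

section \<open>Extending the visit by one backward step\<close>

lemma boundary_pending: "boundary V r \<psi> \<subseteq> pending \<psi> - Out"
proof
  fix v assume "v \<in> boundary V r \<psi>"
  then obtain Q where Q: "v \<in> V - set \<psi>" "Q \<in> r v" "Q \<noteq> {}" "Q \<subseteq> set \<psi>"
    by (auto simp: boundary_def)
  then obtain w where "w \<in> Q" by blast
  then have "(v, w) \<in> E" "w \<in> set \<psi>" using Q enabler_succs by auto
  then show "v \<in> pending \<psi> - Out"
    using Q by (auto simp: pending_def outputs_def succs_def)
qed

text \<open>No edge of \<open>G\<close> leads to an input, so \<open>us\<close> can neither complete
  an enabler nor supply a visited successor. Only \<open>x\<close> can make a vertex
  pending.\<close>

lemma pending_append:
  assumes x: "x \<notin> Inp" and us: "set us \<subseteq> Inp"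
    and v: "v \<in> pending (\<psi> @ x # us)"
  shows "(v, x) \<in> E \<or> v \<in> pending \<psi>"
proof (rule disjCI)
  assume nx: "v \<notin> pending \<psi>"
  show "(v, x) \<in> E"
  proof (rule ccontr)
    assume e: "(v, x) \<notin> E"
    from v obtain Q where Q: "v \<in> V" "v \<notin> set \<psi>" "Q \<in> r v" "Q \<subseteq> set \<psi> \<union> {x} \<union> set us"
      by (auto simp: pending_def)
    have ni: "w \<notin> Inp" if "(v, w) \<in> E" for w using that by (auto simp: inputs_def preds_def)
    have "Q \<subseteq> set \<psi>" using Q enabler_succs[OF Q(1,3)] e ni us by blast
    moreover have "v \<in> Out \<or> (\<exists>w\<in>set \<psi>. (v, w) \<in> E)"
      using v e ni us by (auto simp: pending_def)
    ultimately show False using nx Q by (auto simp: pending_def)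
  qed
qed

text \<open>Going backwards, a pending vertex leaves the cache only at its read, which puts it in
  \<open>S k\<close> and in \<open>Rd\<close>, or at its evaluation, which visits it. It leaves slow
  memory only at its write, when it is in cache.\<close>

lemma timed_visit_step:
  assumes k: "k < N" and tv: "timed_visit \<psi> \<tau>" and rd: "ready (Suc k) \<psi>"
    and le: "Suc k \<le> \<tau> (length \<psi>)"
  shows "\<exists>\<psi> \<tau>. timed_visit \<psi> \<tau> \<and> ready k \<psi> \<and> k \<le> \<tau> (length \<psi>)"
proof (cases "\<exists>x. xs ! k = Compute x \<and> x \<notin> set \<psi> \<and> (\<exists>Q\<in>r x. Q \<subseteq> set \<psi>)")
  case False
  have "ready k \<psi>"
    using step[OF k]
  proof (cases rule: exec_step.cases)
    case (compute_step v)
    then have "v \<notin> pending \<psi>" using False by (auto simp: pending_def)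
    then show ?thesis using rd compute_step by (auto simp: ready_def)
  next
    case (read_step v)
    then have "v \<in> Rd" using k by (auto simp: reads_between_def)
    then show ?thesis using rd read_step by (auto simp: ready_def)
  qed (use rd in \<open>auto simp: ready_def\<close>)
  then show ?thesis using tv le by (meson Suc_leD)
next
  case True
  then obtain x where x: "xs ! k = Compute x" "x \<notin> set \<psi>" "\<exists>Q\<in>r x. Q \<subseteq> set \<psi>" by blast
  have st: "x \<in> V" "x \<notin> Inp" "preds E x \<subseteq> C k" "C (Suc k) = insert x (C k)" "S (Suc k) = S k"
    using step[OF k] x(1) by (auto elim: exec_step.cases)
  \<comment> \<open>No enabler contains an input, so testing against
    \<open>insert x (set \<psi>)\<close> suffices, whatever the order of \<open>us\<close>.\<close>
  define U where "U = {v \<in> Inp \<inter> preds E x. v \<notin> set \<psi> \<and> (\<exists>Q\<in>r v. Q \<subseteq> insert x (set \<psi>))}"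
  have "finite U" using finite_V by (auto simp: U_def inputs_def)
  then obtain us where us: "set us = U" "distinct us" using finite_distinct_list by blast
  have U: "U \<subseteq> Inp" "U \<subseteq> C k" "U \<subseteq> V" "x \<notin> U" "U \<inter> set \<psi> = {}"
    using st by (auto simp: U_def inputs_def)
  define \<psi>' where "\<psi>' = \<psi> @ x # us"
  define \<tau>' where "\<tau>' i = (if i \<le> length \<psi> then \<tau> i else k)" for i
  have rs: "r_sequence V r \<psi>" using tv by (simp add: timed_visit_def)
  \<comment> \<open>Stated for every list from \<open>U\<close> because the boundary matters also at
    the cuts inside \<open>us\<close>, where the remaining inputs of \<open>U\<close> are pending
    but, as operands of \<open>x\<close>, in \<open>C k\<close>.\<close>
  have pend: "pending (\<psi> @ x # vs) \<subseteq> C k \<union> (S k \<inter> (Rd \<union> Out) - Inp)" if "set vs \<subseteq> U" for vs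
  proof
    fix v assume v: "v \<in> pending (\<psi> @ x # vs)"
    then have "v \<noteq> x" by (auto simp: pending_def)
    have "(v, x) \<in> E \<or> v \<in> pending \<psi>"
      using pending_append[OF st(2) _ v] that U by auto
    then show "v \<in> C k \<union> (S k \<inter> (Rd \<union> Out) - Inp)"
      using st rd \<open>v \<noteq> x\<close> by (auto simp: ready_def preds_def)
  qed
  have nI: "pending \<psi>' \<inter> Inp = {}"
  proof (rule ccontr)
    assume "pending \<psi>' \<inter> Inp \<noteq> {}"
    then obtain v where v: "v \<in> pending \<psi>'" "v \<in> Inp" by blast
    have "v \<notin> pending \<psi>" using rd v by (auto simp: ready_def)
    then have vx: "(v, x) \<in> E"
      using pending_append[OF st(2) _ v(1)[unfolded \<psi>'_def]] us U by auto
    from v obtain Q where Q: "v \<in> V" "Q \<in> r v" "Q \<subseteq> set \<psi> \<union> {x} \<union> U"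
      by (auto simp: pending_def \<psi>'_def us)
    have "w \<notin> Inp" if "w \<in> Q" for w
      using enabler_succs[OF Q(1,2) that] by (auto simp: inputs_def preds_def)
    then have "Q \<subseteq> insert x (set \<psi>)" using Q U by blast
    then have "v \<in> U" using v vx Q by (auto simp: U_def preds_def pending_def \<psi>'_def)
    then show False using v us by (auto simp: pending_def \<psi>'_def)
  qed
  have "ready k \<psi>'"
    using nI pend[of us] us by (auto simp: ready_def \<psi>'_def)
  moreover have "k \<le> \<tau>' (length \<psi>')" by (simp add: \<tau>'_def \<psi>'_def)
  moreover have "timed_visit \<psi>' \<tau>'"
    unfolding timed_visit_def
  proof (intro conjI allI impI)
    show "\<tau>' 0 = N" using tv by (simp add: timed_visit_def \<tau>'_def)
    show "r_sequence V r \<psi>'"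
      unfolding r_sequence_def
    proof (intro conjI allI impI)
      show "set \<psi>' \<subseteq> V" using rs st U us by (auto simp: r_sequence_def \<psi>'_def)
      show "distinct \<psi>'" using rs x U us by (auto simp: r_sequence_def \<psi>'_def)
      fix i assume i: "i < length \<psi>'"
      consider "i < length \<psi>" | "i = length \<psi>" | "i > length \<psi>" by linarith
      then show "\<exists>Q\<in>r (\<psi>' ! i). Q \<subseteq> set (take i \<psi>')"
      proof cases
        case 1
        then show ?thesis using rs by (simp add: r_sequence_def \<psi>'_def nth_append)
      next
        case 2
        then show ?thesis using x by (simp add: \<psi>'_def nth_append)
      next
        case 3
        then obtain j where j: "i = length \<psi> + Suc j" using less_imp_Suc_add by fastforce
        then have "\<psi>' ! i \<in> U" using i us by (auto simp: \<psi>'_def nth_append)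
        then obtain Q where "Q \<in> r (\<psi>' ! i)" "Q \<subseteq> insert x (set \<psi>)" by (auto simp: U_def)
        then show ?thesis using j by (intro bexI[of _ Q]) (auto simp: \<psi>'_def)
      qed
    qed
  next
    fix i assume i: "i < length \<psi>'"
    consider "i < length \<psi>" | "i = length \<psi>" | "i > length \<psi>" by linarith
    then have "\<tau>' (Suc i) \<le> \<tau>' i \<and> (\<exists>m. \<tau>' (Suc i) \<le> m \<and> m \<le> \<tau>' i \<and> \<psi>' ! i \<in> C m)"
    proof cases
      case 1
      then show ?thesis using tv by (simp add: timed_visit_def \<tau>'_def \<psi>'_def nth_append)
    next
      case 2
      \<comment> \<open>The evaluation guarantees \<open>x\<close> in cache at state
        \<open>Suc k\<close>, not at \<open>k\<close>; the assumption
        \<open>Suc k \<le> \<tau> (length \<psi>)\<close> puts that state into the interval.\<close>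
      have "\<tau>' (Suc i) \<le> Suc k" "Suc k \<le> \<tau>' i" "\<psi>' ! i \<in> C (Suc k)"
        using 2 le st by (auto simp: \<tau>'_def \<psi>'_def)
      then show ?thesis by (meson le_trans)
    next
      case 3
      then obtain j where j: "i = length \<psi> + Suc j" using less_imp_Suc_add by fastforce
      then have "\<psi>' ! i \<in> U" using i us by (auto simp: \<psi>'_def nth_append)
      then show ?thesis using U 3 by (auto simp: \<tau>'_def)
    qed
    then show "\<tau>' (Suc i) \<le> \<tau>' i" "\<exists>m. \<tau>' (Suc i) \<le> m \<and> m \<le> \<tau>' i \<and> \<psi>' ! i \<in> C m" by auto
  next
    fix i assume i: "i \<le> length \<psi>'"
    show "boundary V r (take i \<psi>') \<subseteq> C (\<tau>' i) \<union> (Rd - Inp)"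
    proof (cases "i \<le> length \<psi>")
      case True
      then show ?thesis using tv by (simp add: timed_visit_def \<tau>'_def \<psi>'_def)
    next
      case False
      then obtain j where j: "i = length \<psi> + Suc j" using less_imp_Suc_add
        by (metis add_Suc_right not_le)
      then have t: "take i \<psi>' = \<psi> @ x # take j us" by (simp add: \<psi>'_def)
      have "set (take j us) \<subseteq> U" using us set_take_subset by metis
      then show ?thesis using pend[of "take j us"] boundary_pending[of "take i \<psi>'"] j
        unfolding t by (auto simp: \<tau>'_def)
    qed
  qed
  ultimately show ?thesis by blast
qed

text \<open>The scan starts with only outputs pending and ends at state 0, where the cache is empty
  and slow memory holds only inputs; so nothing is pending. An unvisited vertex with all successors
  in \<open>G\<close> visited would be pending, so induction starting from the outputs shows that
  every vertex is visited.\<close>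

lemma timed_visit_exists: "\<exists>\<psi> \<tau>. timed_visit \<psi> \<tau> \<and> set \<psi> = V"
proof -
  have "\<exists>\<psi> \<tau>. timed_visit \<psi> \<tau> \<and> ready (N - m) \<psi> \<and> N - m \<le> \<tau> (length \<psi>)" if "m \<le> N" for m
    using that
  proof (induction m)
    case 0
    have "timed_visit [] (\<lambda>_. N)"
      by (auto simp: timed_visit_def r_sequence_def boundary_def)
    moreover have "ready N []"
      using outputs_written disj by (auto simp: ready_def pending_def)
    ultimately show ?case by (intro exI[of _ "[]"] exI[of _ "\<lambda>_. N"]) simp
  next
    case (Suc m)
    then have "Suc (N - Suc m) = N - m" by simp
    then show ?case using Suc timed_visit_step[of "N - Suc m"] by auto
  qed
  from this[of N] obtain \<psi> \<tau> where tv: "timed_visit \<psi> \<tau>" and rd: "ready 0 \<psi>" by auto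
  have pend: "pending \<psi> = {}" using rd by (auto simp: ready_def C_0 S_0)
  have sub: "set \<psi> \<subseteq> V" using tv by (simp add: timed_visit_def r_sequence_def)
  have wf: "wf (E\<inverse>)"
    using dag dag_converse[OF dag] unfolding dag_def
    by (meson finite_SigmaI finite_acyclic_wf finite_subset)
  have "v \<in> V \<longrightarrow> v \<in> set \<psi>" for v
    using wf
  proof (induction v rule: wf_induct_rule)
    case (less v)
    show ?case
    proof (rule impI, rule ccontr)
      assume v: "v \<in> V" "v \<notin> set \<psi>"
      have succ: "w \<in> set \<psi>" if "(v, w) \<in> E" for w using that less edges by auto
      obtain Q where "Q \<in> r v" using rule v unfolding visit_rule_def by blast
      moreover have "Q \<subseteq> set \<psi>" using enabler_succs[OF v(1) \<open>Q \<in> r v\<close>] succ by auto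
      moreover have "v \<in> Out \<or> (\<exists>w\<in>set \<psi>. (v, w) \<in> E)"
        using succ v by (auto simp: outputs_def succs_def)
      ultimately have "v \<in> pending \<psi>" using v by (auto simp: pending_def)
      then show False using pend by simp
    qed
  qed
  then show ?thesis using tv sub by blast
qed

section \<open>Lower bounds on reads and writes from a timed visit\<close>

lemma visit_bounds:
  "\<exists>\<psi>\<in>r_visits V r. W_visit V (E\<inverse>) r \<psi> M \<le> int (num_writes xs) \<and>
     R_visit V (E\<inverse>) \<psi> M \<le> int (num_reads xs) \<and>
     W_visit V (E\<inverse>) r \<psi> M + int (card Inp) - int (card Out) \<le> int (num_reads xs)"
proof -
  obtain \<psi> \<tau> where tv: "timed_visit \<psi> \<tau>" and all: "set \<psi> = V" using timed_visit_exists by blast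
  have rs: "r_sequence V r \<psi>" and \<tau>0: "\<tau> 0 = N"
    and cached: "\<And>i. i < length \<psi> \<Longrightarrow>
      \<tau> (Suc i) \<le> \<tau> i \<and> (\<exists>k. \<tau> (Suc i) \<le> k \<and> k \<le> \<tau> i \<and> \<psi> ! i \<in> C k)"
    and bd: "\<And>i. i \<le> length \<psi> \<Longrightarrow> boundary V r (take i \<psi>) \<subseteq> C (\<tau> i) \<union> (Rd - Inp)"
    using tv by (auto simp: timed_visit_def)
  have dist: "distinct \<psi>" using rs by (simp add: r_sequence_def)
  have anti: "\<tau> b \<le> \<tau> a" if "a \<le> b" "b \<le> length \<psi>" for a b
    using that
  proof (induction b rule: dec_induct)
    case (step b)
    then have "\<tau> (Suc b) \<le> \<tau> b" "\<tau> b \<le> \<tau> a" using cached[of b] by auto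
    then show ?case by simp
  qed simp
  have \<tau>N: "\<tau> i \<le> N" if "i \<le> length \<psi>" for i using anti[of 0 i] that \<tau>0 by simp
  have finRd: "finite Rd" using reads_between_subset[of N 0] finite_V finite_subset by auto
  define Z where "Z = Out \<union> (Rd - Inp)"
  have finO: "finite Out" and finI: "finite Inp" using finite_V by (auto simp: outputs_def inputs_def)
  have finZ: "finite Z" using finO finRd by (simp add: Z_def)
  have W: "W_part V (E\<inverse>) r ix \<psi> M \<le> int (card Z)" if ix: "ix \<in> seg_partitions \<psi>" for ix
  proof -
    \<comment> \<open>What enters outside the cache contents at the cut lies in \<open>Z\<close>,
      and each vertex of \<open>Z\<close> is charged once, to the segment that visits it.\<close>
    let ?F = "\<lambda>i. int (card (Z \<inter> set (take i \<psi>)))"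
    have "W_part V (E\<inverse>) r ix \<psi> M \<le> ?F (length \<psi>) - ?F 0"
      unfolding W_part_def
    proof (rule sum_seg_partition_le[OF ix])
      fix a b assume ab: "a \<le> b" "b \<le> length \<psi>"
      let ?s = "set (segment \<psi> a b)"
      have fC: "finite (C (\<tau> a))" "card (C (\<tau> a)) \<le> M"
        using state_subset[OF \<tau>N] ab finite_V finite_subset by (meson le_trans)+
      have "(Out \<union> boundary V r (take a \<psi>)) \<inter> ?s \<subseteq> C (\<tau> a) \<union> (Z \<inter> ?s)"
        using bd[of a] ab by (auto simp: Z_def)
      then have "entering V (E\<inverse>) r \<psi> a b \<le> card (C (\<tau> a) \<union> (Z \<inter> ?s))"
        unfolding entering_def inputs_converse using fC by (intro card_mono) auto
      also have "\<dots> \<le> M + card (Z \<inter> ?s)"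
        using fC card_Un_le[of "C (\<tau> a)" "Z \<inter> ?s"] by simp
      finally show "max 0 (int (entering V (E\<inverse>) r \<psi> a b) - int M) \<le> ?F b - ?F a"
        using card_Int_segment[OF dist ab(1), of Z] by simp
    qed
    also have "\<dots> \<le> int (card Z)" using finZ by (simp add: card_mono)
    finally show ?thesis .
  qed
  have R: "R_part V (E\<inverse>) ix \<psi> M \<le> int (num_reads xs)" if ix: "ix \<in> seg_partitions \<psi>" for ix
  proof -
    \<comment> \<open>The visit runs against time, so \<open>\<tau>\<close> decreases and this
      potential increases: the segment is charged the reads between states \<open>\<tau> b\<close>
      and \<open>\<tau> a\<close>.\<close>
    let ?F = "\<lambda>i. - int (num_reads (take (\<tau> i) xs))"
    have "R_part V (E\<inverse>) ix \<psi> M \<le> ?F (length \<psi>) - ?F 0"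
      unfolding R_part_def
    proof (rule sum_seg_partition_le[OF ix])
      fix a b assume ab: "a \<le> b" "b \<le> length \<psi>"
      let ?s = "set (segment \<psi> a b)"
      have fC: "finite (C (\<tau> b))" "card (C (\<tau> b)) \<le> M"
        using state_subset[OF \<tau>N] ab finite_V finite_subset by (meson le_trans)+
      have ba: "\<tau> b \<le> \<tau> a" "\<tau> a \<le> N" using anti \<tau>N ab by auto
      have "?s \<subseteq> (\<Union>k\<in>{\<tau> b..\<tau> a}. C k)"
      proof
        fix v assume "v \<in> ?s"
        then obtain i where "i < b - a" "v = \<psi> ! (a + i)"
          using ab by (auto simp: segment_def in_set_conv_nth)
        then have i: "a + i < length \<psi>" "Suc (a + i) \<le> b" and v: "v = \<psi> ! (a + i)" using ab by auto
        from cached[OF i(1)] v obtain k where "\<tau> (Suc (a + i)) \<le> k" "k \<le> \<tau> (a + i)" "v \<in> C k" by auto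
        moreover have "\<tau> b \<le> \<tau> (Suc (a + i))" "\<tau> (a + i) \<le> \<tau> a" using anti i ab by auto
        ultimately show "v \<in> (\<Union>k\<in>{\<tau> b..\<tau> a}. C k)" by force
      qed
      then have "post_dominator V (E\<inverse>) (C (\<tau> b) \<union> reads_between (\<tau> b) (\<tau> a)) ?s"
        using cache_dominated[OF ba] by (meson post_dominator_def subset_iff)
      then have "pd_min V (E\<inverse>) ?s \<le> card (C (\<tau> b) \<union> reads_between (\<tau> b) (\<tau> a))"
        using pd_min_le finite_V by blast
      also have "\<dots> \<le> M + card (reads_between (\<tau> b) (\<tau> a))"
        using fC card_Un_le[of "C (\<tau> b)" "reads_between (\<tau> b) (\<tau> a)"] by simp
      finally show "max 0 (int (pd_min V (E\<inverse>) ?s) - int M) \<le> ?F b - ?F a"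
        using card_reads_between[OF ba] by simp
    qed
    then show ?thesis using \<tau>0 by simp
  qed
  \<comment> \<open>Every input is visited, hence cached at some time, which requires a
    read.\<close>
  have I_Rd: "Inp \<subseteq> Rd"
  proof
    fix v assume v: "v \<in> Inp"
    then have "v \<in> set \<psi>" using all by (auto simp: inputs_def)
    then obtain i where i: "i < length \<psi>" "v = \<psi> ! i" by (auto simp: in_set_conv_nth)
    then obtain k where "k \<le> \<tau> i" "v \<in> C k" using cached by blast
    moreover have "\<tau> i \<le> N" using \<tau>N i by simp
    ultimately have "k \<le> N" "v \<in> reads_between 0 k" using cached_input_read[of k] v by auto
    then show "v \<in> Rd" by (auto simp: reads_between_def dest: less_le_trans)
  qed
  have WZ: "W_visit V (E\<inverse>) r \<psi> M \<le> int (card Z)"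
    unfolding W_visit_def using W finite_seg_partitions seg_partitions_nonempty
    by (subst Max_le_iff) auto
  have "card Z \<le> num_writes xs"
    using card_mono[of written Z] card_written reads_written outputs_subset_written
    by (simp add: Z_def)
  moreover have "R_visit V (E\<inverse>) \<psi> M \<le> int (num_reads xs)"
    unfolding R_visit_def using R finite_seg_partitions seg_partitions_nonempty
    by (subst Max_le_iff) auto
  moreover have "card Z + card Inp \<le> card Out + num_reads xs"
  proof -
    have "card Z \<le> card Out + card (Rd - Inp)" unfolding Z_def by (rule card_Un_le)
    moreover have "card (Rd - Inp) + card Inp = card Rd"
      using I_Rd finRd finI by (metis card_Diff_subset card_mono le_add_diff_inverse2)
    moreover have "card Rd \<le> num_reads xs" using card_reads_between[of 0 N] by simp
    ultimately show ?thesis by simp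
  qed
  moreover have "\<psi> \<in> r_visits V r" using rs all by (simp add: r_visits_def)
  ultimately show ?thesis using WZ by (intro bexI[of _ \<psi>]) auto
qed

end

text \<open>A single visit satisfies all the bounds; this matters for reads plus writes, where the
  estimates are added for the same visit.\<close>

lemma computation_visit:
  assumes "dag V E" "inputs V E \<inter> outputs V E = {}" "visit_rule V (E\<inverse>) r"
    and xs: "xs \<in> computations V E M"
  shows "\<exists>\<psi>\<in>r_visits V r. W_visit V (E\<inverse>) r \<psi> M \<le> int (num_writes xs) \<and>
     R_visit V (E\<inverse>) \<psi> M \<le> int (num_reads xs) \<and>
     W_visit V (E\<inverse>) r \<psi> M + int (card (inputs V E)) - int (card (outputs V E)) \<le> int (num_reads xs)"
proof -
  from xs obtain C S where ex: "exec V E M ({}, inputs V E) xs (C, S)" "outputs V E \<subseteq> S"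
    by (auto simp: computations_def)
  then obtain st where st: "st 0 = ({}, inputs V E)" "st (length xs) = (C, S)"
    "\<And>k. k < length xs \<Longrightarrow> exec_step V E M (st k) (xs ! k) (st (Suc k))"
    using exec_states by metis
  interpret computation_run V E r M xs "\<lambda>k. fst (st k)" "\<lambda>k. snd (st k)"
    using assms st ex by unfold_locales auto
  show ?thesis by (rule visit_bounds)
qed

section \<open>Passage to the minima over all computations\<close>

lemma le_INF_enat:
  assumes "\<And>x. x \<in> A \<Longrightarrow> z \<le> int (f x)"
  shows "ereal (of_int z) \<le> ereal_of_enat (INF x\<in>A. enat (f x))"
proof (cases "A = {}")
  case True
  then show ?thesis by (simp add: top_enat_def)
next
  case False
  \<comment> \<open>The infimum of a nonempty set of extended naturals is attained, so one
    computation decides the comparison.\<close>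
  then have "(INF x\<in>A. enat (f x)) \<in> (\<lambda>x. enat (f x)) ` A"
    by (metis (no_types, lifting) Inf_enat_def LeastI ex_in_conv image_is_empty)
  then obtain x where "x \<in> A" "(INF x\<in>A. enat (f x)) = enat (f x)" by auto
  moreover have "real_of_int z \<le> real (f x)" using assms[OF \<open>x \<in> A\<close>] by linarith
  ultimately show ?thesis by simp
qed

theorem theorem19:
  fixes V :: "'a set" and E :: "('a \<times> 'a) set" and r :: "'a \<Rightarrow> 'a set set" and M :: nat
  assumes "dag V E"
    and "inputs V E \<inter> outputs V E = {}"
    and "visit_rule V (E\<inverse>) r"
  shows "ereal_of_enat (IO_W V E M) \<ge>
           ereal (of_int (MIN \<psi>\<in>r_visits V r. W_visit V (E\<inverse>) r \<psi> M))
       \<and> ereal_of_enat (IO_R V E M) \<ge>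
           ereal (of_int (MIN \<psi>\<in>r_visits V r.
             max (R_visit V (E\<inverse>) \<psi> M)
                 (W_visit V (E\<inverse>) r \<psi> M + int (card (inputs V E)) - int (card (outputs V E)))))
       \<and> ereal_of_enat (IO V E M) \<ge>
           ereal (of_int (MIN \<psi>\<in>r_visits V r.
             W_visit V (E\<inverse>) r \<psi> M +
             max (R_visit V (E\<inverse>) \<psi> M)
                 (W_visit V (E\<inverse>) r \<psi> M + int (card (inputs V E)) - int (card (outputs V E)))))"
proof (intro conjI)
  note visit = computation_visit[OF assms]
  have fin: "finite (r_visits V r)" using assms(1) by (simp add: dag_def finite_r_visits)
  have MIN_le: "(MIN \<psi>\<in>r_visits V r. f \<psi>) \<le> z"
    if "\<psi> \<in> r_visits V r" "f \<psi> \<le> z" for f :: "'a list \<Rightarrow> int" and \<psi> z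
    using that fin by (meson Min_le finite_imageI imageI order_trans)
  show "ereal_of_enat (IO_W V E M) \<ge>
      ereal (of_int (MIN \<psi>\<in>r_visits V r. W_visit V (E\<inverse>) r \<psi> M))"
    unfolding IO_W_def using visit by (intro le_INF_enat) (metis (lifting) MIN_le)
  let ?R = "\<lambda>\<psi>. max (R_visit V (E\<inverse>) \<psi> M)
      (W_visit V (E\<inverse>) r \<psi> M + int (card (inputs V E)) - int (card (outputs V E)))"
  show "ereal_of_enat (IO_R V E M) \<ge> ereal (of_int (MIN \<psi>\<in>r_visits V r. ?R \<psi>))"
    unfolding IO_R_def
  proof (rule le_INF_enat)
    fix xs assume "xs \<in> computations V E M"
    from visit[OF this] obtain \<psi> where "\<psi> \<in> r_visits V r" "?R \<psi> \<le> int (num_reads xs)" by auto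
    then show "(MIN \<psi>\<in>r_visits V r. ?R \<psi>) \<le> int (num_reads xs)" by (rule MIN_le)
  qed
  show "ereal_of_enat (IO V E M) \<ge>
      ereal (of_int (MIN \<psi>\<in>r_visits V r. W_visit V (E\<inverse>) r \<psi> M + ?R \<psi>))"
    unfolding IO_def
  proof (rule le_INF_enat)
    fix xs assume "xs \<in> computations V E M"
    from visit[OF this] obtain \<psi> where "\<psi> \<in> r_visits V r"
      "W_visit V (E\<inverse>) r \<psi> M + ?R \<psi> \<le> int (num_reads xs + num_writes xs)" by fastforce
    then show "(MIN \<psi>\<in>r_visits V r. W_visit V (E\<inverse>) r \<psi> M + ?R \<psi>)
        \<le> int (num_reads xs + num_writes xs)" by (rule MIN_le)
  qed
qed

end
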